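(* Let $d\ge 1$, and let $\mu: t \mapsto \mu_{t}\in\mathbb{R}^d$ and $A: t \mapsto A_{t}\in \mathrm{M}_d(\mathbb{R})$ be differentiable curves defined on an interval containing $0$, with $A_0$ invertible. If $\mu$ and $A$ satisfy the equations $$\dot{\mu}_{t} = A_{t}A_{t}^{T} J_{\mu},\qquad \dot{A}_{t} = \frac{1}{2} \left(J_{\Sigma } - J_{\mu}\,\mu_{t}^{T}\right)^{T} A_{t},$$ where $$J_{\mu} = (A_{0}^{-1})^{T} A_{0}^{-1} \dot{\mu}_{0}\qquad\text{and}\qquad J_{\Sigma} = (A_{0}^{-1})^{T} A_{0}^{-1} \left(\dot{\mu}_{0}\, \mu_{0}^{T} + \dot{A}_{0} A_{0}^{T} + A_{0} \dot{A}_{0}^{T} \right),$$ then $t\mapsto \mathcal{N} (\mu_{t}, A_{t}A_{t}^{T})$ is a geodesic of $\mathbb{G}_d$.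
   Context: $\mathbb{G}_d$ is the manifold of (nondegenerate) Gaussian distributions $\mathcal N(\mu,\Sigma)$ on $\mathbb{R}^d$, with global coordinates $(\mu,\Sigma)$, $\mu\in\mathbb{R}^d$ (column vector), $\Sigma$ a real symmetric positive definite $d\times d$ matrix. It is equipped with the Fisher metric, for which the squared norm of a tangent vector $(\dot\mu,\dot\Sigma)$ ($\dot\mu\in\mathbb{R}^d$, $\dot\Sigma$ symmetric) at $\mathcal N(\mu,\Sigma)$ is $$\dot\mu^{T}\Sigma^{-1}\dot\mu+\tfrac12\operatorname{tr}(\dot\Sigma\Sigma^{-1}\dot\Sigma\Sigma^{-1}).$$ Geodesics are the usual (constant speed, possibly constant) Riemannian geodesics. A dot denotes the derivative in $t$; $\dot\mu_0,\dot A_0$ are the derivatives at $t=0$. *)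

theory Defs
  imports "HOL-Analysis.Analysis"
begin

section \<open>Geodesics in a global chart\<close>

text \<open>
  A manifold with one global chart is given by a relatively open subset \<open>U\<close> of a linear
  subspace \<open>W\<close> of a Euclidean space; \<open>W\<close> is the tangent space at every point of \<open>U\<close>.
  A Riemannian metric is a map \<open>g\<close> such that \<open>g p\<close> restricted to \<open>W\<close> is the inner product at
  \<open>p \<in> U\<close>.
\<close>

definition metric_deriv ::
    "('a::euclidean_space \<Rightarrow> 'a \<Rightarrow> 'a \<Rightarrow> real) \<Rightarrow> 'a \<Rightarrow> 'a \<Rightarrow> 'a \<Rightarrow> 'a \<Rightarrow> real" where
  "metric_deriv g p Z X Y = deriv (\<lambda>s. g (p + s *\<^sub>R Z) X Y) 0"

text \<open>
  The Levi-Civita covariant derivative at \<open>p\<close> of the constant vector field \<open>Y\<close> in direction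
  \<open>X\<close>, that is \<open>\<Sum>\<^sub>k \<Gamma>\<^sup>k\<^sub>i\<^sub>j X\<^sup>i Y\<^sup>j e\<^sub>k\<close>, characterised by the Koszul formula
  (constant fields have vanishing brackets). The vector is unique because \<open>g p\<close> is positive
  definite on the finite-dimensional space \<open>W\<close>.
\<close>

definition christoffel ::
    "'a::euclidean_space set \<Rightarrow> ('a \<Rightarrow> 'a \<Rightarrow> 'a \<Rightarrow> real) \<Rightarrow> 'a \<Rightarrow> 'a \<Rightarrow> 'a \<Rightarrow> 'a" where
  "christoffel W g p X Y =
     (THE C. C \<in> W \<and>
        (\<forall>Z\<in>W. g p C Z = (metric_deriv g p X Y Z + metric_deriv g p Y X Z
                            - metric_deriv g p Z X Y) / 2))"

text \<open>
  \<open>\<gamma>\<close> stays in \<open>U\<close> and its covariant acceleration vanishes; derivatives at end points of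
  \<open>I\<close> are one-sided.
\<close>

definition geodesic_on ::
    "'a::euclidean_space set \<Rightarrow> 'a set \<Rightarrow> ('a \<Rightarrow> 'a \<Rightarrow> 'a \<Rightarrow> real) \<Rightarrow> real set \<Rightarrow> (real \<Rightarrow> 'a) \<Rightarrow> bool"
  where
  "geodesic_on W U g I \<gamma> \<longleftrightarrow>
     (\<exists>v a. \<forall>t\<in>I. \<gamma> t \<in> U \<and>
        (\<gamma> has_vector_derivative v t) (at t within I) \<and>
        (v has_vector_derivative a t) (at t within I) \<and>
        a t + christoffel W g (\<gamma> t) (v t) (v t) = 0)"


section \<open>The manifold of Gaussian distributions\<close>

definition sym_pos_def :: "real^'d^'d \<Rightarrow> bool" where
  "sym_pos_def S \<longleftrightarrow> transpose S = S \<and> (\<forall>x. x \<noteq> 0 \<longrightarrow> x \<bullet> (S *v x) > 0)"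

definition gaussian :: "real^'d \<Rightarrow> real^'d^'d \<Rightarrow> (real^'d) measure" where
  "gaussian m S = density lborel
     (\<lambda>x. ennreal (exp (- ((x - m) \<bullet> (matrix_inv S *v (x - m))) / 2)
                    / sqrt ((2 * pi) ^ CARD('d) * det S)))"

definition gaussian_coords :: "((real^'d) \<times> (real^'d^'d)) set" where
  "gaussian_coords = {(m, S). sym_pos_def S}"

definition gaussian_tangent :: "((real^'d) \<times> (real^'d^'d)) set" where
  "gaussian_tangent = {(v, T). transpose T = T}"

text \<open>The polarisation of the quadratic form
  \<open>v\<^sup>T S\<^sup>-\<^sup>1 v + tr (T S\<^sup>-\<^sup>1 T S\<^sup>-\<^sup>1) / 2\<close>.\<close>

definition fisher_metric ::
    "(real^'d) \<times> (real^'d^'d) \<Rightarrow> (real^'d) \<times> (real^'d^'d) \<Rightarrow> (real^'d) \<times> (real^'d^'d) \<Rightarrow> real" where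
  "fisher_metric = (\<lambda>(m, S) (v, T) (v', T').
     v \<bullet> (matrix_inv S *v v') + trace (T ** matrix_inv S ** T' ** matrix_inv S) / 2)"

text \<open>
  A curve of Gaussian distributions is a geodesic iff its expression in the global coordinates
  is one. The coordinate curve is unique, since \<open>(m, S) \<mapsto> gaussian m S\<close> is injective on
  \<open>gaussian_coords\<close>.
\<close>

definition gaussian_geodesic_on :: "real set \<Rightarrow> (real \<Rightarrow> (real^'d) measure) \<Rightarrow> bool" where
  "gaussian_geodesic_on I \<nu> \<longleftrightarrow>
     (\<exists>m S. (\<forall>t\<in>I. \<nu> t = gaussian (m t) (S t)) \<and>
        geodesic_on gaussian_tangent gaussian_coords fisher_metric I (\<lambda>t. (m t, S t)))"

text \<open>The matrix \<open>v w\<^sup>T\<close> of column vectors \<open>v\<close> and \<open>w\<close>.\<close>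

definition outer_product :: "real^'m \<Rightarrow> real^'n \<Rightarrow> real^'n^'m" where
  "outer_product v w = (\<chi> i j. v $ i * w $ j)"

end

theory Submission
  imports Defs
begin

text \<open>
  Put \<open>S\<^sub>t = A\<^sub>t A\<^sub>t\<^sup>T\<close> and \<open>K\<^sub>t = J\<^sub>\<Sigma> - J\<^sub>\<mu> \<mu>\<^sub>t\<^sup>T\<close>. The Fisher metric is invariant under affine maps
  of the sample space, and \<open>J\<^sub>\<mu>\<close> and \<open>J\<^sub>\<Sigma>\<close> are the conserved momenta of translations and
  linear maps: along a geodesic, \<open>\<mu>' = S J\<^sub>\<mu>\<close> and \<open>S' = S K\<close>. Conversely these two first-order
  equations imply the geodesic equations
  \[ \mu'' = S' S^{-1} \mu', \qquad S'' = S' S^{-1} S' - \mu' \mu'^T, \]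
  by one differentiation, because \<open>K' = - J\<^sub>\<mu> \<mu>'\<^sup>T = - J\<^sub>\<mu> J\<^sub>\<mu>\<^sup>T S\<close>
  (lemma \<open>conserved_momenta_imp_geodesic\<close>). The right-hand sides come from the Christoffel symbols
  of the Fisher metric (lemma \<open>christoffel_fisher_metric\<close>), which are verified through the Koszul
  formula and the derivative of matrix inversion.

  The equation \<open>A' = K\<^sup>T A / 2\<close> gives only \<open>S' = (S K + K\<^sup>T S) / 2\<close>, so one must see that \<open>S K\<close>
  is symmetric for all times. The defect \<open>D = S K - K\<^sup>T S\<close> solves the linear equation
  \<open>D' = (D K + K\<^sup>T D) / 2\<close>, since the contribution of \<open>K'\<close> is the symmetric matrix
  \<open>- \<mu>' \<mu>'\<^sup>T\<close> and cancels. The definitions of \<open>J\<^sub>\<mu>\<close> and \<open>J\<^sub>\<Sigma>\<close> say that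
  \<open>D\<^sub>0 = 0\<close>, hence \<open>D = 0\<close> by uniqueness (lemma \<open>symmetric_product_preserved\<close>). The same uniqueness
  principle, applied to \<open>A x\<close> for a fixed vector \<open>x\<close>, shows that \<open>A\<close> stays invertible
  (lemma \<open>linear_ode_invertible\<close>), so \<open>S\<close> stays positive definite.
\<close>

section \<open>Matrix algebra\<close>

lemma matrix_inv_works:
  fixes B :: "real^'n^'n"
  assumes "invertible B"
  shows "B ** matrix_inv B = mat 1" "matrix_inv B ** B = mat 1"
proof -
  have "\<exists>C. B ** C = mat 1 \<and> C ** B = mat 1"
    using assms by (simp add: invertible_def)
  then have "B ** matrix_inv B = mat 1 \<and> matrix_inv B ** B = mat 1"
    unfolding matrix_inv_def by (rule someI_ex)
  then show "B ** matrix_inv B = mat 1" "matrix_inv B ** B = mat 1" by auto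
qed

lemma bounded_bilinear_matrix_mult:
  "bounded_bilinear ((**) :: real^'n^'m \<Rightarrow> real^'p^'n \<Rightarrow> real^'p^'m)"
  unfolding bilinear_conv_bounded_bilinear[symmetric] bilinear_def linear_iff
  by (simp add: matrix_matrix_mult_def vec_eq_iff sum.distrib sum_distrib_left algebra_simps)

lemma bounded_bilinear_matrix_vector_mult:
  "bounded_bilinear ((*v) :: real^'n^'m \<Rightarrow> real^'n \<Rightarrow> real^'m)"
  unfolding bilinear_conv_bounded_bilinear[symmetric] bilinear_def linear_iff
  by (simp add: matrix_vector_mult_def vec_eq_iff sum.distrib sum_distrib_left algebra_simps)

lemma bounded_linear_transpose:
  "bounded_linear (transpose :: real^'n^'m \<Rightarrow> real^'m^'n)"
  unfolding linear_conv_bounded_linear[symmetric] linear_iff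
  by (simp add: transpose_def vec_eq_iff)

lemma bounded_linear_trace: "bounded_linear (trace :: real^'n^'n \<Rightarrow> real)"
  unfolding linear_conv_bounded_linear[symmetric] linear_iff
  by (simp add: trace_def sum.distrib sum_distrib_left)

lemma bounded_linear_outer_product:
  "bounded_linear (outer_product (u :: real^'m) :: real^'n \<Rightarrow> real^'n^'m)"
  unfolding linear_conv_bounded_linear[symmetric] linear_iff
  by (simp add: outer_product_def vec_eq_iff algebra_simps)

interpretation matmul: bounded_bilinear
  "(**) :: real^'n^'m \<Rightarrow> real^'p^'n \<Rightarrow> real^'p^'m"
  by (rule bounded_bilinear_matrix_mult)

interpretation matvec: bounded_bilinear "(*v) :: real^'n^'m \<Rightarrow> real^'n \<Rightarrow> real^'m"
  by (rule bounded_bilinear_matrix_vector_mult)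

lemmas transpose_linear =
  linear_add[OF bounded_linear.linear[OF bounded_linear_transpose]]
  linear_diff[OF bounded_linear.linear[OF bounded_linear_transpose]]
  linear_scale[OF bounded_linear.linear[OF bounded_linear_transpose]]

lemmas matmul_linear =
  matmul.add_left matmul.add_right matmul.diff_left matmul.diff_right
  matmul.scaleR_left matmul.scaleR_right matmul.minus_left matmul.minus_right

lemma transpose_outer_product: "transpose (outer_product u v) = outer_product v u"
  by (simp add: outer_product_def transpose_def vec_eq_iff)

lemma matrix_mult_outer_product:
  fixes M :: "real^'n^'m"
  shows "M ** outer_product u v = outer_product (M *v u) v"
  by (simp add: outer_product_def matrix_matrix_mult_def matrix_vector_mult_def vec_eq_iff
      sum_distrib_right mult.assoc)

lemma trace_outer_product_mult:
  fixes N :: "real^'n^'n"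
  shows "trace (outer_product u v ** N) = v \<bullet> (N *v u)"
proof -
  have "trace (outer_product u v ** N) = trace (N ** outer_product u v)"
    by (rule trace_mul_sym)
  also have "\<dots> = v \<bullet> (N *v u)"
    unfolding matrix_mult_outer_product
    by (simp add: trace_def outer_product_def inner_vec_def mult.commute)
  finally show ?thesis .
qed

lemma inner_matrix_vector_mult:
  fixes M :: "real^'n^'m"
  shows "x \<bullet> (M *v y) = (transpose M *v x) \<bullet> y"
  by (simp add: dot_lmul_matrix)

lemma trace_minus: "trace (- N) = - trace (N :: real^'n^'n)"
  by (simp add: trace_def sum_negf)

lemma trace_transpose_mult_self:
  fixes E :: "real^'n^'n"
  shows "trace (transpose E ** E) = E \<bullet> E"
  unfolding trace_def inner_vec_def transpose_def matrix_matrix_mult_def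
  by (simp, subst sum.swap, rule refl)

section \<open>Uniqueness for linear differential equations\<close>

text \<open>
  On the segment between \<open>t0\<close> and \<open>t\<close> the factor \<open>k\<close> is bounded by some \<open>L\<close>, so
  \<open>exp (-2 L s) |y s|\<^sup>2\<close> decreases and \<open>exp (2 L s) |y s|\<^sup>2\<close> increases there. Both are
  nonnegative and vanish at \<open>t0\<close>; the first settles \<open>t \<ge> t0\<close>, the second \<open>t < t0\<close>.
\<close>

lemma gronwall_zero:
  fixes y :: "real \<Rightarrow> 'a::real_inner"
  assumes I: "is_interval I" and t0: "t0 \<in> I" and t: "t \<in> I"
    and dy: "\<And>s. s \<in> I \<Longrightarrow> (y has_vector_derivative y' s) (at s within I)"
    and bound: "\<And>s. s \<in> I \<Longrightarrow> norm (y' s) \<le> k s * norm (y s)"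
    and k: "continuous_on I k"
    and zero: "y t0 = 0"
  shows "y t = 0"
proof -
  let ?a = "min t0 t" and ?b = "max t0 t"
  have sub: "{?a..?b} \<subseteq> I"
  proof
    fix s assume "s \<in> {?a..?b}"
    then show "s \<in> I"
      using mem_is_interval_1_I[OF I, of ?a ?b s] t0 t by (simp add: min_def max_def)
  qed
  have "bounded (k ` {?a..?b})"
    by (intro compact_imp_bounded compact_continuous_image continuous_on_subset[OF k sub] compact_Icc)
  then obtain L where L: "\<And>s. s \<in> {?a..?b} \<Longrightarrow> \<bar>k s\<bar> \<le> L"
    unfolding bounded_iff real_norm_def by blast
  define h where "h c s = exp (c * s) * (y s \<bullet> y s)" for c s
  define h' where "h' c s = exp (c * s) * (c * (y s \<bullet> y s) + 2 * (y s \<bullet> y' s))" for c s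
  have dh: "(h c has_real_derivative h' c s) (at s within {?a..?b})" if "s \<in> {?a..?b}" for c s
  proof -
    have "(y has_vector_derivative y' s) (at s within {?a..?b})"
      by (rule has_vector_derivative_within_subset[OF dy sub]) (use sub that in blast)
    from bounded_bilinear.has_vector_derivative[OF bounded_bilinear_inner this this]
    have "((\<lambda>s. y s \<bullet> y s) has_real_derivative 2 * (y s \<bullet> y' s)) (at s within {?a..?b})"
      unfolding has_real_derivative_iff_has_vector_derivative by (simp add: inner_commute)
    then show ?thesis
      unfolding h_def[abs_def] h'_def
      by (auto intro!: derivative_eq_intros simp: algebra_simps)
  qed
  have mvt: "\<exists>s\<in>{?a..?b}. h c ?b - h c ?a = h' c s * (?b - ?a)" for c
    using mvt_very_simple[of ?a ?b "h c" "\<lambda>s. (*) (h' c s)"] dh[of _ c]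
    by (auto simp: has_field_derivative_def)
  have inner_bound: "\<bar>y s \<bullet> y' s\<bar> \<le> L * (y s \<bullet> y s)" if "s \<in> {?a..?b}" for s
  proof -
    have "\<bar>y s \<bullet> y' s\<bar> \<le> norm (y s) * norm (y' s)" by (rule Cauchy_Schwarz_ineq2)
    also have "\<dots> \<le> norm (y s) * (L * norm (y s))"
    proof (intro mult_left_mono norm_ge_zero)
      have "norm (y' s) \<le> k s * norm (y s)" using bound sub that by blast
      also have "\<dots> \<le> L * norm (y s)" using L[OF that] by (intro mult_right_mono) auto
      finally show "norm (y' s) \<le> L * norm (y s)" .
    qed
    also have "\<dots> = L * (y s \<bullet> y s)" by (simp add: dot_square_norm power2_eq_square)
    finally show ?thesis .
  qed
  show ?thesis
  proof (cases "t0 \<le> t")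
    case True
    obtain s where s: "s \<in> {?a..?b}" and eq: "h (-2*L) ?b - h (-2*L) ?a = h' (-2*L) s * (?b - ?a)"
      using mvt by blast
    have "h' (-2*L) s \<le> 0"
      unfolding h'_def using inner_bound[OF s] by (intro mult_nonneg_nonpos) auto
    then have "h (-2*L) t - h (-2*L) t0 \<le> 0"
      using eq True by (simp add: mult_nonpos_nonneg min_def max_def split: if_splits)
    then have "exp (-2*L*t) * (y t \<bullet> y t) \<le> 0" by (simp add: h_def zero)
    then show ?thesis
      by (simp add: mult_le_0_iff not_le) (metis inner_ge_zero inner_eq_zero_iff order_antisym)
  next
    case False
    obtain s where s: "s \<in> {?a..?b}" and eq: "h (2*L) ?b - h (2*L) ?a = h' (2*L) s * (?b - ?a)"
      using mvt by blast
    have "h' (2*L) s \<ge> 0"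
      unfolding h'_def using inner_bound[OF s] by (intro mult_nonneg_nonneg) auto
    then have "h (2*L) t0 - h (2*L) t \<ge> 0"
      using eq False by (simp add: min_def max_def)
    then have "exp (2*L*t) * (y t \<bullet> y t) \<le> 0" by (simp add: h_def zero)
    then show ?thesis
      by (simp add: mult_le_0_iff not_le) (metis inner_ge_zero inner_eq_zero_iff order_antisym)
  qed
qed

section \<open>The Christoffel symbols of the Fisher metric\<close>

text \<open>
  With \<open>R s = (S + s Z)\<^sup>-\<^sup>1\<close> and \<open>P = S\<^sup>-\<^sup>1\<close>, everything follows from the resolvent identity
  \<open>R s = P - s R s Z P\<close>: for small \<open>s\<close> it bounds \<open>R s\<close>, hence shows \<open>R s \<longlongrightarrow> P\<close>, and then
  its difference quotient tends to \<open>- P Z P\<close>.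
\<close>

lemma matrix_inv_add_scaleR_derivative:
  fixes S Z :: "real^'n^'n"
  assumes S: "invertible S"
  shows "((\<lambda>s. matrix_inv (S + s *\<^sub>R Z)) has_vector_derivative
           - (matrix_inv S ** Z ** matrix_inv S)) (at 0)"
proof -
  define P where "P = matrix_inv S"
  define R where "R s = matrix_inv (S + s *\<^sub>R Z)" for s
  obtain c where c: "0 < c"
    "\<And>(X::real^'n^'n) (Y::real^'n^'n). norm (X ** Y) \<le> norm X * norm Y * c"
    using matmul.pos_bounded by blast
  have "continuous_on UNIV (\<lambda>s::real. det (S + s *\<^sub>R Z))"
    unfolding det_def by (intro continuous_intros)
  then have "((\<lambda>s. det (S + s *\<^sub>R Z)) \<longlongrightarrow> det (S + 0 *\<^sub>R Z)) (at 0)"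
    unfolding continuous_on_def by blast
  moreover have "det (S + 0 *\<^sub>R Z) \<noteq> 0" using S by (simp add: invertible_det_nz)
  ultimately have "\<forall>\<^sub>F s in at 0. det (S + s *\<^sub>R Z) \<noteq> 0"
    by (rule tendsto_imp_eventually_ne)
  then have ev: "\<forall>\<^sub>F s in at 0. R s = P - s *\<^sub>R (R s ** (Z ** P))"
  proof (rule eventually_mono)
    fix s assume "det (S + s *\<^sub>R Z) \<noteq> 0"
    then have inv: "invertible (S + s *\<^sub>R Z)" by (simp add: invertible_det_nz)
    have "R s ** (S + s *\<^sub>R Z) ** P = P"
      unfolding R_def by (simp add: matrix_inv_works[OF inv])
    moreover have "R s ** S ** P = R s"
      unfolding P_def by (simp add: matrix_mul_assoc[symmetric] matrix_inv_works[OF S])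
    ultimately show "R s = P - s *\<^sub>R (R s ** (Z ** P))"
      by (simp add: matmul_linear matrix_mul_assoc algebra_simps)
  qed
  have small: "\<forall>\<^sub>F s in at 0. \<bar>s\<bar> * (norm (Z ** P) * c) < 1/2"
  proof -
    have "((\<lambda>s::real. \<bar>s\<bar> * (norm (Z ** P) * c)) \<longlongrightarrow> 0) (at 0)"
      by (auto intro!: tendsto_eq_intros)
    then show ?thesis by (rule order_tendstoD) simp
  qed
  have "\<forall>\<^sub>F s in at 0. norm (R s - P) \<le> \<bar>s\<bar> * (2 * norm P * norm (Z ** P) * c)"
    using ev small
  proof eventually_elim
    case (elim s)
    have step: "norm (s *\<^sub>R (R s ** (Z ** P))) \<le> \<bar>s\<bar> * (norm (R s) * norm (Z ** P) * c)"
      using c(2)[of "R s" "Z ** P"] by (simp add: mult_left_mono)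
    have "norm (R s) \<le> norm P + norm (s *\<^sub>R (R s ** (Z ** P)))"
      by (subst elim(1)) (rule norm_triangle_ineq4)
    also have "\<dots> \<le> norm P + (\<bar>s\<bar> * (norm (Z ** P) * c)) * norm (R s)"
      using step by (simp add: ac_simps)
    also have "\<dots> \<le> norm P + (1/2) * norm (R s)"
      using elim(2) by (intro add_left_mono mult_right_mono) auto
    finally have "norm (R s) \<le> 2 * norm P" by simp
    then have "\<bar>s\<bar> * (norm (R s) * norm (Z ** P) * c) \<le> \<bar>s\<bar> * (2 * norm P * norm (Z ** P) * c)"
      using c(1) by (intro mult_left_mono mult_right_mono) auto
    moreover have "norm (R s - P) = norm (s *\<^sub>R (R s ** (Z ** P)))"
      by (subst elim(1)) simp
    ultimately show ?case using step by linarith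
  qed
  moreover have "((\<lambda>s::real. \<bar>s\<bar> * (2 * norm P * norm (Z ** P) * c)) \<longlongrightarrow> 0) (at 0)"
    by (auto intro!: tendsto_eq_intros)
  ultimately have "((\<lambda>s. R s - P) \<longlongrightarrow> 0) (at 0)"
    by (rule Lim_null_comparison)
  from tendsto_minus[OF this] have "((\<lambda>s. P - R s) \<longlongrightarrow> 0) (at 0)" by simp
  then have "((\<lambda>s. norm ((P - R s) ** (Z ** P))) \<longlongrightarrow> norm ((0::real^'n^'n) ** (Z ** P))) (at 0)"
    by (intro tendsto_norm matmul.tendsto tendsto_const)
  then have lim: "((\<lambda>s. norm ((P - R s) ** (Z ** P))) \<longlongrightarrow> 0) (at 0)"
    by (simp add: matmul.zero_left)
  have R0: "R 0 = P" by (simp add: R_def P_def)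
  have "((\<lambda>s. norm (R (0 + s) - R 0 - s *\<^sub>R (- (P ** Z ** P))) / norm s) \<longlongrightarrow> 0) (at 0)"
  proof (rule Lim_transform_eventually[OF lim])
    show "\<forall>\<^sub>F s in at 0. norm ((P - R s) ** (Z ** P))
            = norm (R (0 + s) - R 0 - s *\<^sub>R (- (P ** Z ** P))) / norm s"
      using ev eventually_neq_at_within[of 0 0 UNIV]
    proof eventually_elim
      case (elim s)
      have "R s - P = - (s *\<^sub>R (R s ** (Z ** P)))"
        by (subst elim(1)) simp
      then have "R (0 + s) - R 0 - s *\<^sub>R (- (P ** Z ** P)) = s *\<^sub>R ((P - R s) ** (Z ** P))"
        by (simp add: R0 matmul_linear matrix_mul_assoc algebra_simps)
      then show ?case using elim by simp
    qed
  qed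
  then have "(R has_vector_derivative - (P ** Z ** P)) (at 0)"
    unfolding has_vector_derivative_def has_derivative_at
    using bounded_linear_minus[OF bounded_linear_scaleR_left] by simp
  then show ?thesis by (simp add: R_def[abs_def] P_def)
qed


lemma metric_deriv_fisher_metric:
  fixes S Z X Y :: "real^'d^'d"
  assumes S: "invertible S"
  defines "P \<equiv> matrix_inv S"
  shows "metric_deriv fisher_metric (m, S) (z, Z) (x, X) (y, Y) =
     - (x \<bullet> ((P ** Z ** P) *v y))
     - (trace (X ** (P ** Z ** P) ** Y ** P) + trace (X ** P ** Y ** (P ** Z ** P))) / 2"
proof -
  define R where "R s = matrix_inv (S + s *\<^sub>R Z)" for s
  define Q where "Q = P ** Z ** P"
  have R0: "R 0 = P" by (simp add: R_def P_def)
  have dR: "(R has_vector_derivative - Q) (at 0)"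
    using matrix_inv_add_scaleR_derivative[OF S, of Z] by (simp add: R_def[abs_def] P_def Q_def)
  have "((\<lambda>s. x \<bullet> (R s *v y)) has_vector_derivative x \<bullet> (- Q *v y)) (at 0)"
    by (intro bounded_linear.has_vector_derivative[OF bounded_linear_inner_right]
        bounded_linear.has_vector_derivative[OF matvec.bounded_linear_left] dR)
  moreover have "((\<lambda>s. trace ((X ** R s) ** (Y ** R s))) has_vector_derivative
      trace ((X ** R 0) ** (Y ** - Q) + (X ** - Q) ** (Y ** R 0))) (at 0)"
    by (intro bounded_linear.has_vector_derivative[OF bounded_linear_trace]
        matmul.has_vector_derivative
        bounded_linear.has_vector_derivative[OF matmul.bounded_linear_right] dR)
  ultimately have "((\<lambda>s. x \<bullet> (R s *v y) + trace ((X ** R s) ** (Y ** R s)) / 2)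
      has_real_derivative x \<bullet> (- Q *v y)
        + trace ((X ** R 0) ** (Y ** - Q) + (X ** - Q) ** (Y ** R 0)) / 2) (at 0)"
    unfolding has_real_derivative_iff_has_vector_derivative[symmetric]
    by (auto intro!: derivative_eq_intros)
  from DERIV_imp_deriv[OF this] show ?thesis
    unfolding metric_deriv_def fisher_metric_def
    by (simp add: R0 R_def[symmetric] Q_def[symmetric] matmul_linear matvec.minus_left
        matrix_mul_assoc trace_add trace_sub trace_minus add_divide_distrib)
qed

text \<open>
  Test vectors that undo the inverses in the metric make the pairings Euclidean: for
  \<open>C - C' = (w, E)\<close>, the pairing with \<open>(S w, 0)\<close> gives \<open>|w|\<^sup>2\<close> and that with \<open>(0, S E S)\<close>
  gives half of \<open>tr (E E)\<close>, which is half the squared Euclidean norm of the symmetric matrix \<open>E\<close>.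
\<close>

lemma fisher_metric_nondegenerate:
  assumes S: "invertible S" "transpose S = S"
    and C: "C \<in> gaussian_tangent" and C': "C' \<in> gaussian_tangent"
    and eq: "\<And>V. V \<in> gaussian_tangent \<Longrightarrow>
      fisher_metric (m, S) C V = fisher_metric (m, S) C' V"
  shows "C = C'"
proof -
  obtain c D c' D' where CD: "C = (c, D)" "C' = (c', D')" by (cases C, cases C')
  define E where "E = D - D'"
  have E: "transpose E = E"
    using C C' by (simp add: CD E_def gaussian_tangent_def transpose_linear)
  have inv: "matrix_inv S ** S = mat 1" "S ** matrix_inv S = mat 1"
    using matrix_inv_works[OF S(1)] by auto
  have "(S *v (c - c'), 0) \<in> gaussian_tangent"
    by (simp add: gaussian_tangent_def transpose_def vec_eq_iff)
  from eq[OF this] have "c \<bullet> (c - c') = c' \<bullet> (c - c')"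
    by (simp add: CD fisher_metric_def matrix_vector_mul_assoc inv matmul.zero_left matmul.zero_right)
  then have "(c - c') \<bullet> (c - c') = 0" by (simp add: inner_diff_left)
  moreover have "E \<bullet> E = 0"
  proof -
    have cancel: "trace (F ** matrix_inv S ** (S ** E ** S) ** matrix_inv S) = trace (F ** E)"
      for F
    proof -
      have "F ** matrix_inv S ** (S ** E ** S) ** matrix_inv S
          = F ** (matrix_inv S ** S) ** E ** (S ** matrix_inv S)"
        by (simp only: matrix_mul_assoc)
      then show ?thesis by (simp add: inv)
    qed
    have "(0, S ** E ** S) \<in> gaussian_tangent"
      by (simp add: gaussian_tangent_def matrix_transpose_mul S E matrix_mul_assoc)
    from eq[OF this] have "trace (D ** E) = trace (D' ** E)"
      by (simp add: CD fisher_metric_def cancel)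
    then have "trace (transpose E ** E) = 0"
      unfolding E using matmul.diff_left[of D D' E] by (simp add: E_def[symmetric] trace_sub)
    then show ?thesis by (simp only: trace_transpose_mult_self)
  qed
  ultimately show ?thesis by (simp add: CD E_def)
qed

text \<open>
  The covariance parts of the derivatives of the metric are traces of words in \<open>T\<close>, \<open>Z\<close> and \<open>P\<close>,
  and each of these words is a cyclic rotation of \<open>T P T P Z P\<close>. The Koszul formula therefore reduces to
  \<open>- v\<^sup>T P T P z + v\<^sup>T P Z P v / 2 - tr (T P T P Z P) / 2\<close>, from which the solution can be read off:
  the middle term is half the trace of \<open>v v\<^sup>T P Z P\<close>.
\<close>

lemma christoffel_fisher_metric:
  fixes S T :: "real^'d^'d"
  assumes S: "invertible S" "transpose S = S" and T: "transpose T = T"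
  defines "P \<equiv> matrix_inv S"
  shows "christoffel gaussian_tangent fisher_metric (m, S) (v, T) (v, T) =
    (- (T ** P *v v), outer_product v v - T ** P ** T)" (is "_ = ?C")
proof -
  have SP: "S ** P = mat 1" and PS: "P ** S = mat 1"
    using matrix_inv_works[OF S(1)] by (auto simp: P_def)
  have P: "transpose P = P"
  proof -
    have "transpose P ** S = mat 1"
      using arg_cong[OF SP, of transpose] by (simp add: matrix_transpose_mul S)
    then have "transpose P ** S ** P = P" by simp
    then show ?thesis by (simp add: matrix_mul_assoc[symmetric] SP)
  qed
  let ?K = "\<lambda>V. (metric_deriv fisher_metric (m, S) (v, T) (v, T) V
      + metric_deriv fisher_metric (m, S) (v, T) (v, T) V
      - metric_deriv fisher_metric (m, S) V (v, T) (v, T)) / 2"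
  have C: "?C \<in> gaussian_tangent"
    by (simp add: gaussian_tangent_def transpose_linear transpose_outer_product
        matrix_transpose_mul T P matrix_mul_assoc)
  have koszul: "fisher_metric (m, S) ?C V = ?K V" if "V \<in> gaussian_tangent" for V
  proof -
    obtain z Z where V: "V = (z, Z)" by (cases V)
    have cyc1: "trace (T ** (P ** T ** P) ** Z ** P) = trace (T ** P ** T ** P ** Z ** P)"
      by (simp add: matrix_mul_assoc)
    have cyc2: "trace (T ** P ** Z ** (P ** T ** P)) = trace (T ** P ** T ** P ** Z ** P)"
      using trace_mul_sym[of "T ** P ** Z ** P" "T ** P"] by (simp add: matrix_mul_assoc)
    have cyc3: "trace (T ** (P ** Z ** P) ** T ** P) = trace (T ** P ** T ** P ** Z ** P)"
      using trace_mul_sym[of "T ** P ** Z ** P" "T ** P"] by (simp add: matrix_mul_assoc)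
    have cyc4: "trace (T ** P ** T ** (P ** Z ** P)) = trace (T ** P ** T ** P ** Z ** P)"
      by (simp add: matrix_mul_assoc)
    have vec: "(T ** P *v v) \<bullet> (P *v z) = v \<bullet> ((P ** T ** P) *v z)"
      unfolding inner_matrix_vector_mult
      by (simp only: matrix_transpose_mul P T matrix_vector_mul_assoc matrix_mul_assoc)
    have "fisher_metric (m, S) ?C V = - (v \<bullet> ((P ** T ** P) *v z))
        + (v \<bullet> ((P ** Z ** P) *v v) - trace (T ** P ** T ** P ** Z ** P)) / 2"
      unfolding V fisher_metric_def P_def[symmetric] prod.case
      by (simp only: matmul.diff_left trace_sub matrix_mul_assoc[symmetric] trace_outer_product_mult)
         (simp only: matrix_mul_assoc inner_minus_left vec)
    then show ?thesis
      unfolding V metric_deriv_fisher_metric[OF S(1)] P_def[symmetric] cyc1 cyc2 cyc3 cyc4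
      by (simp add: field_simps)
  qed
  show ?thesis
    unfolding christoffel_def
  proof (rule the_equality)
    show "?C \<in> gaussian_tangent \<and> (\<forall>V\<in>gaussian_tangent. fisher_metric (m, S) ?C V = ?K V)"
      using C koszul by blast
  next
    fix C' assume C': "C' \<in> gaussian_tangent \<and>
      (\<forall>V\<in>gaussian_tangent. fisher_metric (m, S) C' V = ?K V)"
    show "C' = ?C"
    proof (rule fisher_metric_nondegenerate[OF S _ C])
      show "C' \<in> gaussian_tangent" using C' by blast
    next
      fix V :: "(real^'d) \<times> (real^'d^'d)"
      assume "V \<in> gaussian_tangent"
      with C' koszul show "fisher_metric (m, S) C' V = fisher_metric (m, S) ?C V" by metis
    qed
  qed
qed


lemma sym_pos_def_mult_transpose:
  fixes B :: "real^'d^'d"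
  assumes "invertible B"
  shows "sym_pos_def (B ** transpose B)"
  unfolding sym_pos_def_def
proof (intro conjI allI impI)
  show "transpose (B ** transpose B) = B ** transpose B"
    by (simp add: matrix_transpose_mul)
next
  fix x :: "real^'d" assume "x \<noteq> 0"
  have "x = transpose (matrix_inv B) *v (transpose B *v x)"
    by (simp only: matrix_vector_mul_assoc matrix_transpose_mul[symmetric]
        matrix_inv_works[OF assms] transpose_mat matrix_vector_mul_lid)
  with \<open>x \<noteq> 0\<close> have "transpose B *v x \<noteq> 0"
    by (metis matvec.zero_right)
  moreover have "x \<bullet> ((B ** transpose B) *v x) = (transpose B *v x) \<bullet> (transpose B *v x)"
    by (simp only: matrix_vector_mul_assoc[symmetric] inner_matrix_vector_mult)
  ultimately show "x \<bullet> ((B ** transpose B) *v x) > 0" by simp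
qed

section \<open>The first-order equations for the curve\<close>

text \<open>
  If \<open>A t x = 0\<close>, then \<open>s \<mapsto> A s x\<close> solves \<open>y' = M y\<close> and vanishes at \<open>t\<close>, hence everywhere;
  at \<open>t0\<close> this forces \<open>x = 0\<close>.
\<close>

lemma linear_ode_invertible:
  fixes A M :: "real \<Rightarrow> real^'d^'d"
  assumes I: "is_interval I" "t0 \<in> I" "t \<in> I"
    and dA: "\<And>s. s \<in> I \<Longrightarrow> (A has_vector_derivative M s ** A s) (at s within I)"
    and M: "continuous_on I M"
    and inv: "invertible (A t0)"
  shows "invertible (A t)"
proof -
  obtain c where c: "\<And>(N::real^'d^'d) (x::real^'d). norm (N *v x) \<le> norm N * norm x * c"
    using matvec.pos_bounded by blast
  have "x = 0" if x: "A t *v x = 0" for x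
  proof -
    have "A t0 *v x = 0"
    proof (rule gronwall_zero[OF I(1) I(3) I(2), where y = "\<lambda>s. A s *v x"
          and y' = "\<lambda>s. M s *v (A s *v x)" and k = "\<lambda>s. norm (M s) * c"])
      show "((\<lambda>s. A s *v x) has_vector_derivative M s *v (A s *v x)) (at s within I)"
        if "s \<in> I" for s
        using bounded_linear.has_vector_derivative[OF matvec.bounded_linear_left dA[OF that]]
        by (simp add: matrix_vector_mul_assoc)
      show "norm (M s *v (A s *v x)) \<le> norm (M s) * c * norm (A s *v x)" for s
        using c[of "M s" "A s *v x"] by (simp add: ac_simps)
      show "continuous_on I (\<lambda>s. norm (M s) * c)"
        by (intro continuous_intros M)
      show "A t *v x = 0" by (rule x)
    qed
    then have "matrix_inv (A t0) ** A t0 *v x = 0"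
      by (simp add: matrix_vector_mul_assoc[symmetric] matvec.zero_right)
    then show "x = 0" by (simp add: matrix_inv_works[OF inv])
  qed
  then show ?thesis
    using matrix_left_invertible_ker[of "A t"] invertible_left_inverse[of "A t"] by blast
qed

text \<open>
  The antisymmetric defect \<open>D = S K - K\<^sup>T S\<close> satisfies \<open>D' = (D K + K\<^sup>T D) / 2\<close>: the terms
  \<open>K\<^sup>T S K\<close> from the derivative of \<open>S\<close> cancel, and so do the terms with \<open>K'\<close> because
  \<open>S K'\<close> is symmetric.
\<close>

lemma symmetric_product_preserved:
  fixes S K K' :: "real \<Rightarrow> real^'d^'d"
  assumes I: "is_interval I" "t0 \<in> I" "t \<in> I"
    and S: "\<And>s. s \<in> I \<Longrightarrow> transpose (S s) = S s"
    and dS: "\<And>s. s \<in> I \<Longrightarrow> (S has_vector_derivative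
               (1/2) *\<^sub>R (S s ** K s + transpose (K s) ** S s)) (at s within I)"
    and dK: "\<And>s. s \<in> I \<Longrightarrow> (K has_vector_derivative K' s) (at s within I)"
    and K': "\<And>s. s \<in> I \<Longrightarrow> transpose (S s ** K' s) = S s ** K' s"
    and init: "transpose (S t0 ** K t0) = S t0 ** K t0"
  shows "transpose (S t ** K t) = S t ** K t"
proof -
  define D where "D s = S s ** K s - transpose (K s) ** S s" for s
  define D' where "D' s = (1/2) *\<^sub>R (D s ** K s + transpose (K s) ** D s)" for s
  obtain c where c: "\<And>(X::real^'d^'d) (Y::real^'d^'d). norm (X ** Y) \<le> norm X * norm Y * c"
    using matmul.pos_bounded by blast
  have contK: "continuous_on I K"
    using dK by (rule continuous_on_vector_derivative)
  have "D t = 0"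
  proof (rule gronwall_zero[OF I, where y = D and y' = D'
        and k = "\<lambda>s. c / 2 * (norm (K s) + norm (transpose (K s)))"])
    show "(D has_vector_derivative D' s) (at s within I)" if s: "s \<in> I" for s
    proof -
      have "transpose (K' s) ** S s = S s ** K' s"
        using K'[OF s] by (simp add: matrix_transpose_mul S[OF s])
      moreover have "(D has_vector_derivative
          (S s ** K' s + (1/2) *\<^sub>R (S s ** K s + transpose (K s) ** S s) ** K s)
          - (transpose (K s) ** ((1/2) *\<^sub>R (S s ** K s + transpose (K s) ** S s))
             + transpose (K' s) ** S s)) (at s within I)"
        unfolding D_def[abs_def]
        by (intro has_vector_derivative_diff matmul.has_vector_derivative
            bounded_linear.has_vector_derivative[OF bounded_linear_transpose] dS dK s)
      ultimately show ?thesis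
        by (simp add: D'_def D_def matmul_linear matrix_mul_assoc algebra_simps)
    qed
    show "norm (D' s) \<le> c / 2 * (norm (K s) + norm (transpose (K s))) * norm (D s)" for s
    proof -
      have "norm (D' s) \<le> (norm (D s ** K s) + norm (transpose (K s) ** D s)) / 2"
        unfolding D'_def using norm_triangle_ineq[of "D s ** K s"] by simp
      also have "\<dots> \<le> (norm (D s) * norm (K s) * c + norm (transpose (K s)) * norm (D s) * c) / 2"
        by (intro divide_right_mono add_mono c) auto
      finally show ?thesis by (simp add: field_simps)
    qed
    show "continuous_on I (\<lambda>s. c / 2 * (norm (K s) + norm (transpose (K s))))"
      by (intro continuous_intros contK bounded_linear.continuous_on[OF bounded_linear_transpose])
    show "D t0 = 0"
      using init by (simp add: D_def matrix_transpose_mul S[OF I(2)])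
  qed
  then show ?thesis
    by (simp add: D_def matrix_transpose_mul S[OF I(3)])
qed

text \<open>
  Here \<open>J\<close> is the conserved momentum of translations. The covariant acceleration of the velocity
  \<open>(S J, S K)\<close> vanishes iff \<open>(S J)' = S K J\<close> and \<open>(S K)' = S K K - (S J) (S J)\<^sup>T\<close>, after \<open>S\<^sup>-\<^sup>1\<close>
  has cancelled in the Christoffel symbols. Both are instances of the product rule.
\<close>

lemma conserved_momenta_imp_geodesic:
  fixes \<mu> :: "real \<Rightarrow> real^'d" and S K :: "real \<Rightarrow> real^'d^'d"
  assumes pd: "\<And>t. t \<in> I \<Longrightarrow> sym_pos_def (S t)"
    and inv: "\<And>t. t \<in> I \<Longrightarrow> invertible (S t)"
    and sym: "\<And>t. t \<in> I \<Longrightarrow> transpose (S t ** K t) = S t ** K t"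
    and d\<mu>: "\<And>t. t \<in> I \<Longrightarrow> (\<mu> has_vector_derivative S t *v J) (at t within I)"
    and dS: "\<And>t. t \<in> I \<Longrightarrow> (S has_vector_derivative S t ** K t) (at t within I)"
    and dK: "\<And>t. t \<in> I \<Longrightarrow>
               (K has_vector_derivative - outer_product J (S t *v J)) (at t within I)"
  shows "geodesic_on gaussian_tangent gaussian_coords fisher_metric I (\<lambda>t. (\<mu> t, S t))"
  unfolding geodesic_on_def
proof (intro exI ballI conjI)
  fix t assume t: "t \<in> I"
  let ?v = "\<lambda>t. (S t *v J, S t ** K t)"
  let ?a = "\<lambda>t. (S t ** K t *v J,
                 S t ** K t ** K t - outer_product (S t *v J) (S t *v J))"
  show "(\<mu> t, S t) \<in> gaussian_coords"
    using pd[OF t] by (simp add: gaussian_coords_def)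
  show "((\<lambda>t. (\<mu> t, S t)) has_vector_derivative ?v t) (at t within I)"
    by (intro has_vector_derivative_Pair d\<mu> dS t)
  have "((\<lambda>t. S t ** K t) has_vector_derivative
      S t ** - outer_product J (S t *v J) + S t ** K t ** K t) (at t within I)"
    by (intro matmul.has_vector_derivative dS dK t)
  then have "((\<lambda>t. S t ** K t) has_vector_derivative
      S t ** K t ** K t - outer_product (S t *v J) (S t *v J)) (at t within I)"
    by (simp add: matmul.minus_right matrix_mult_outer_product)
  then show "(?v has_vector_derivative ?a t) (at t within I)"
    by (intro has_vector_derivative_Pair
        bounded_linear.has_vector_derivative[OF matvec.bounded_linear_left] dS t)
  have S: "transpose (S t) = S t" using pd[OF t] by (simp add: sym_pos_def_def)
  have cancel: "S t ** K t ** matrix_inv (S t) ** S t = S t ** K t"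
    by (simp add: matrix_mul_assoc[symmetric] matrix_inv_works[OF inv[OF t]])
  show "?a t + christoffel gaussian_tangent fisher_metric (\<mu> t, S t) (?v t) (?v t) = 0"
    unfolding christoffel_fisher_metric[OF inv[OF t] S sym[OF t]]
    by (simp add: matrix_vector_mul_assoc matrix_mul_assoc cancel zero_prod_def)
qed

theorem theorem20:
  fixes I :: "real set"
    and \<mu> \<mu>' :: "real \<Rightarrow> real^'d"
    and A A' :: "real \<Rightarrow> real^'d^'d"
    and J\<^sub>\<mu> :: "real^'d"
    and J\<^sub>\<Sigma> :: "real^'d^'d"
  assumes "is_interval I" and "0 \<in> I"
    and "\<And>t. t \<in> I \<Longrightarrow> (\<mu> has_vector_derivative \<mu>' t) (at t within I)"
    and "\<And>t. t \<in> I \<Longrightarrow> (A has_vector_derivative A' t) (at t within I)"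
    and "invertible (A 0)"
    and "J\<^sub>\<mu> = (transpose (matrix_inv (A 0)) ** matrix_inv (A 0)) *v \<mu>' 0"
    and "J\<^sub>\<Sigma> = transpose (matrix_inv (A 0)) ** matrix_inv (A 0) **
           (outer_product (\<mu>' 0) (\<mu> 0) + A' 0 ** transpose (A 0) + A 0 ** transpose (A' 0))"
    and "\<And>t. t \<in> I \<Longrightarrow> \<mu>' t = (A t ** transpose (A t)) *v J\<^sub>\<mu>"
    and "\<And>t. t \<in> I \<Longrightarrow>
           A' t = (1/2) *\<^sub>R (transpose (J\<^sub>\<Sigma> - outer_product J\<^sub>\<mu> (\<mu> t)) ** A t)"
  shows "gaussian_geodesic_on I (\<lambda>t. gaussian (\<mu> t) (A t ** transpose (A t)))"
proof -
  define S where "S t = A t ** transpose (A t)" for t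
  define K where "K t = J\<^sub>\<Sigma> - outer_product J\<^sub>\<mu> (\<mu> t)" for t
  have S_sym: "transpose (S t) = S t" for t
    by (simp add: S_def matrix_transpose_mul)
  have d\<mu>: "(\<mu> has_vector_derivative S t *v J\<^sub>\<mu>) (at t within I)" if "t \<in> I" for t
    using assms(3)[OF that] assms(8)[OF that] by (simp add: S_def)
  have dA: "(A has_vector_derivative (1/2) *\<^sub>R transpose (K t) ** A t) (at t within I)"
    if "t \<in> I" for t
    using assms(4)[OF that] assms(9)[OF that] by (simp add: K_def matmul.scaleR_left)
  have dK: "(K has_vector_derivative - outer_product J\<^sub>\<mu> (S t *v J\<^sub>\<mu>)) (at t within I)"
    if "t \<in> I" for t
    using has_vector_derivative_diff[OF has_vector_derivative_const
        bounded_linear.has_vector_derivative[OF bounded_linear_outer_product d\<mu>[OF that]]]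
    by (simp add: K_def[abs_def])
  have dS: "(S has_vector_derivative
      (1/2) *\<^sub>R (S t ** K t + transpose (K t) ** S t)) (at t within I)" if "t \<in> I" for t
    using matmul.has_vector_derivative[OF dA[OF that]
        bounded_linear.has_vector_derivative[OF bounded_linear_transpose dA[OF that]]]
    by (simp add: S_def[abs_def] matrix_transpose_mul transpose_linear matmul_linear
        matrix_mul_assoc algebra_simps)

  have invA: "invertible (A t)" if "t \<in> I" for t
  proof (rule linear_ode_invertible[OF assms(1,2) that dA _ assms(5)])
    show "continuous_on I (\<lambda>t. (1/2) *\<^sub>R transpose (K t))"
      using continuous_on_vector_derivative[OF dK]
      by (intro continuous_intros bounded_linear.continuous_on[OF bounded_linear_transpose])
  qed
  have invS: "invertible (S t)" if "t \<in> I" for t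
    unfolding S_def using invA[OF that] by (intro invertible_mult transpose_invertible)

  have init: "transpose (S 0 ** K 0) = S 0 ** K 0"
  proof -
    let ?P = "transpose (matrix_inv (A 0)) ** matrix_inv (A 0)"
    have "transpose (A 0) ** transpose (matrix_inv (A 0)) = mat 1"
      by (simp only: matrix_transpose_mul[symmetric] matrix_inv_works[OF assms(5)] transpose_mat)
    then have "A 0 ** (transpose (A 0) ** transpose (matrix_inv (A 0))) ** matrix_inv (A 0) = mat 1"
      by (simp add: matrix_inv_works[OF assms(5)])
    then have SP: "S 0 ** ?P = mat 1" by (simp add: S_def matrix_mul_assoc)
    \<comment> \<open>The summand \<open>\<mu>'\<^sub>0 \<mu>\<^sub>0\<^sup>T\<close> of \<open>J\<^sub>\<Sigma>\<close> is what \<open>J\<^sub>\<mu> \<mu>\<^sub>0\<^sup>T\<close> removes; what is left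
      is \<open>S\<^sub>0\<^sup>-\<^sup>1\<close> times the symmetric derivative of \<open>A A\<^sup>T\<close> at \<open>0\<close>.\<close>
    have "K 0 = ?P ** (A' 0 ** transpose (A 0) + A 0 ** transpose (A' 0))"
      unfolding K_def assms(6,7) matrix_mult_outer_product[symmetric] by (simp add: matmul_linear)
    then have "S 0 ** K 0 = A' 0 ** transpose (A 0) + A 0 ** transpose (A' 0)"
      by (simp only: matrix_mul_assoc[of "S 0" ?P] SP matrix_mul_lid)
    then show ?thesis by (simp add: transpose_linear matrix_transpose_mul)
  qed
  have sym: "transpose (S t ** K t) = S t ** K t" if t: "t \<in> I" for t
  proof (rule symmetric_product_preserved[OF assms(1,2) t S_sym dS dK _ init])
    show "transpose (S s ** - outer_product J\<^sub>\<mu> (S s *v J\<^sub>\<mu>))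
        = S s ** - outer_product J\<^sub>\<mu> (S s *v J\<^sub>\<mu>)" for s
      by (simp add: matmul.minus_right matrix_mult_outer_product
          linear_neg[OF bounded_linear.linear[OF bounded_linear_transpose]]
          transpose_outer_product)
  qed
  have dS': "(S has_vector_derivative S t ** K t) (at t within I)" if "t \<in> I" for t
  proof -
    have "transpose (K t) ** S t = S t ** K t"
      using sym[OF that] by (simp add: matrix_transpose_mul S_sym)
    then show ?thesis using dS[OF that] by (simp add: scaleR_2[symmetric])
  qed

  have "geodesic_on gaussian_tangent gaussian_coords fisher_metric I (\<lambda>t. (\<mu> t, S t))"
  proof (rule conserved_momenta_imp_geodesic[OF _ invS sym d\<mu> dS' dK])
    show "sym_pos_def (S t)" if "t \<in> I" for t
      unfolding S_def by (rule sym_pos_def_mult_transpose[OF invA[OF that]])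
  qed
  then show ?thesis
    unfolding gaussian_geodesic_on_def S_def by (intro exI conjI) auto
qed

end
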